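(* Let $n\ge 1$ and $\mathbf{A}\in\mathbb{C}^{n\times n}$. (a) If $\mathbf{A}$ is Hermitian, then $z\in\mathbb{C}$ is a fremdervalue of $\mathbf{A}$ if and only if $z\in\mathbb{R}$ and $\min\lambda(\mathbf{A})<z<\max\lambda(\mathbf{A})$. (b) If $\mathbf{A}$ is skew-Hermitian, then $z\in\mathbb{C}$ is a fremdervalue of $\mathbf{A}$ if and only if $\mathrm{Re}(z)=0$ and $\min\mathrm{Im}(\lambda(\mathbf{A}))<\mathrm{Im}(z)<\max\mathrm{Im}(\lambda(\mathbf{A}))$.
   Context: $\langle\cdot,\cdot\rangle$ is the usual inner product on $\mathbb{C}^n$, $\mathbf{M}^\dagger$ is the conjugate transpose of $\mathbf{M}$, $\lambda(\mathbf{M})$ is the spectrum of $\mathbf{M}$, and $\mathrm{Im}(\lambda(\mathbf{M}))$ is the set of imaginary parts of the elements of $\lambda(\mathbf{M})$. For $\mathbf{M}\in\mathbb{C}^{n\times n}$, a fremdervector of $\mathbf{M}$ is a vector $x\in\mathbb{C}^n$ with $\langle x,\mathbf{M}x\rangle=0$; it is nontrivial if $x\notin\ker(\mathbf{M})\cup\ker(\mathbf{M}^\dagger)$. A scalar $z\in\mathbb{C}$ is a fremdervalue of $\mathbf{A}$ if $z\mathbf{I}-\mathbf{A}$ has a nontrivial fremdervector. *)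

theory Defs
  imports "Jordan_Normal_Form.Spectral_Radius" "Jordan_Normal_Form.Matrix_Kernel"
    "Jordan_Normal_Form.Schur_Decomposition"
begin

definition hermitian_mat :: "complex mat \<Rightarrow> bool" where
  "hermitian_mat M \<longleftrightarrow> mat_adjoint M = M"

definition skew_hermitian_mat :: "complex mat \<Rightarrow> bool" where
  "skew_hermitian_mat M \<longleftrightarrow> mat_adjoint M = - M"

(* The definitions below are meant for square matrices. The inner product \<bullet>c is conjugate-linear
   in its second argument; by conjugate symmetry, the vanishing of <x, M x> does not depend on
   which argument is conjugated. *)
definition fremdervector :: "complex mat \<Rightarrow> complex vec \<Rightarrow> bool" where
  "fremdervector M x \<longleftrightarrow> x \<in> carrier_vec (dim_row M) \<and> x \<bullet>c (M *\<^sub>v x) = 0"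

definition nontrivial_fremdervector :: "complex mat \<Rightarrow> complex vec \<Rightarrow> bool" where
  "nontrivial_fremdervector M x \<longleftrightarrow>
     fremdervector M x \<and> x \<notin> mat_kernel M \<union> mat_kernel (mat_adjoint M)"

definition fremdervalue :: "complex mat \<Rightarrow> complex \<Rightarrow> bool" where
  "fremdervalue A z \<longleftrightarrow> (\<exists>x. nontrivial_fremdervector (z \<cdot>\<^sub>m 1\<^sub>m (dim_row A) - A) x)"

(* The spectrum is a set of complex numbers, which are not linearly ordered. For a Hermitian matrix
   it consists of real numbers, so its minimum and maximum are taken in the type of reals
   as those of Re ` spectrum A. For n \<ge> 1 the sets under Min and Max are finite and nonempty. *)

end

theory Submission
  imports Defs
begin

text \<open>
  Both cases concern a normal matrix whose eigenvalues lie on a line \<open>c \<real>\<close> through the origin, with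
  \<open>c = 1\<close> for Hermitian and \<open>c = \<i>\<close> for skew-Hermitian matrices.  Such a matrix is unitarily
  similar to a diagonal matrix: by Schur's theorem (\<open>unitary_triangularization\<close>) it is unitarily
  similar to a triangular one, which inherits the symmetry and is therefore diagonal.  Nontrivial
  fremdervectors are carried along by unitary changes of basis (\<open>nontrivial_fremdervector_unitary\<close>),
  so only diagonal matrices have to be examined.

  For a diagonal matrix with entries \<open>d\<^sub>i\<close>, a vector \<open>y\<close> enters the quadratic form of \<open>z I - D\<close> only
  through the weights \<open>w\<^sub>i = \<bar>y\<^sub>i\<bar>\<^sup>2\<close>.  Hence \<open>z\<close> is a fremdervalue exactly if some
  nonnegative weights balance the differences \<open>z - d\<^sub>i\<close> to \<open>0\<close> without all of the weighted
  differences vanishing (\<open>fremdervalue_diagonal_iff\<close>); in other words, \<open>z\<close> is a weighted mean of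
  the \<open>d\<^sub>i\<close> in which some \<open>d\<^sub>i\<close> other than \<open>z\<close> has positive weight.  Weighted means of points on the line
  \<open>c \<real>\<close> stay on it, and there the differences can be balanced nontrivially exactly if they occur
  with both signs, that is, if \<open>z\<close> lies strictly between the extreme \<open>d\<^sub>i\<close>
  (\<open>complex_balanced_weights_iff\<close>).  As the \<open>d\<^sub>i\<close> are the eigenvalues, this is the claim.
\<close>

section \<open>Adjoints of matrices\<close>

lemma mat_adjoint_carrier [simp]:
  "A \<in> carrier_mat nr nc \<Longrightarrow> mat_adjoint A \<in> carrier_mat nc nr"
  unfolding mat_adjoint_def by auto

lemma dim_mat_adjoint [simp]:
  "dim_row (mat_adjoint A) = dim_col A" "dim_col (mat_adjoint A) = dim_row A"
  unfolding mat_adjoint_def by auto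

lemma index_mat_adjoint [simp]:
  assumes "i < dim_col A" "j < dim_row A"
  shows "mat_adjoint A $$ (i, j) = conjugate (A $$ (j, i))"
  using assms unfolding mat_adjoint_def by (simp add: mat_of_rows_index)

lemma mat_adjoint_adjoint [simp]: "mat_adjoint (mat_adjoint A) = A"
  by (rule eq_matI) auto

lemma mat_adjoint_one [simp]: "mat_adjoint (1\<^sub>m n :: complex mat) = 1\<^sub>m n"
  by (rule eq_matI) auto

lemma mat_adjoint_mult:
  fixes A B :: "'a :: conjugatable_field mat"
  assumes "A \<in> carrier_mat nr n" "B \<in> carrier_mat n nc"
  shows "mat_adjoint (A * B) = mat_adjoint B * mat_adjoint A"
proof (rule eq_matI)
  fix i j assume "i < dim_row (mat_adjoint B * mat_adjoint A)"
    "j < dim_col (mat_adjoint B * mat_adjoint A)"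
  then show "mat_adjoint (A * B) $$ (i, j) = (mat_adjoint B * mat_adjoint A) $$ (i, j)"
    using assms by (simp add: scalar_prod_def sum_conjugate conjugate_dist_mul mult.commute)
qed (use assms in auto)

lemma mat_adjoint_four_block:
  fixes A :: "'a :: conjugatable_field mat"
  assumes "A \<in> carrier_mat n n" "D \<in> carrier_mat m m"
  shows "mat_adjoint (four_block_mat A (0\<^sub>m n m) (0\<^sub>m m n) D)
    = four_block_mat (mat_adjoint A) (0\<^sub>m n m) (0\<^sub>m m n) (mat_adjoint D)"
  using assms by (intro eq_matI) auto

lemma cscalar_prod_mult_mat_vec:
  fixes A :: "'a :: conjugatable_field mat"
  assumes A: "A \<in> carrier_mat nr nc" and x: "x \<in> carrier_vec nr" and y: "y \<in> carrier_vec nc"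
  shows "x \<bullet>c (A *\<^sub>v y) = (mat_adjoint A *\<^sub>v x) \<bullet>c y"
proof -
  have "x \<bullet>c (A *\<^sub>v y) = (\<Sum>i<nr. \<Sum>j<nc. conjugate (A $$ (i, j)) * x $ i * conjugate (y $ j))"
    using assms by (auto simp: scalar_prod_def sum_conjugate conjugate_dist_mul sum_distrib_left
        lessThan_atLeast0 ac_simps intro!: sum.cong)
  also have "\<dots> = (\<Sum>j<nc. \<Sum>i<nr. conjugate (A $$ (i, j)) * x $ i * conjugate (y $ j))"
    by (rule sum.swap)
  also have "\<dots> = (mat_adjoint A *\<^sub>v x) \<bullet>c y"
    using assms by (auto simp: scalar_prod_def sum_distrib_left
        lessThan_atLeast0 ac_simps intro!: sum.cong)
  finally show ?thesis .
qed

section \<open>Unitary triangularization\<close>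

text \<open>Gram-Schmidt applied to a basis that starts with \<open>v\<close> keeps the first vector, so its output
  only has to be normalized; \<open>c\<close> is the normalizing factor of \<open>v\<close>.\<close>

lemma unitary_with_first_column:
  fixes v :: "complex vec"
  assumes v: "v \<in> carrier_vec n" and v0: "v \<noteq> 0\<^sub>v n"
  obtains W c where "W \<in> carrier_mat n n" "mat_adjoint W * W = 1\<^sub>m n" "col W 0 = c \<cdot>\<^sub>v v"
proof -
  interpret cof_vec_space n "TYPE(complex)" .
  define b where "b = basis_completion v"
  define ws where "ws = gram_schmidt n b"
  note b = basis_completion[OF v v0, folded b_def]
  note ws = gram_schmidt_result[OF b(2,4,5) ws_def]
  have len: "length ws = n" using ws(4) b(6) by simp
  have n: "n \<noteq> 0" using v v0 by (intro notI) auto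
  from b(7) b(6) n obtain vs where "b = v # vs" by (cases b) auto
  then have "hd ws = v" using gram_schmidt_hd[OF v, of vs] unfolding ws_def by simp
  then have ws_0: "ws ! 0 = v" using len n by (cases ws) auto
  define k :: "nat \<Rightarrow> complex" where "k i = inverse (csqrt (ws ! i \<bullet>c ws ! i))" for i
  define W where "W = mat_of_cols n (map (\<lambda>i. k i \<cdot>\<^sub>v ws ! i) [0..<n])"
  have wsc: "ws ! i \<in> carrier_vec n" if "i < n" for i
    using ws(3) len that by auto
  have col: "col W i = k i \<cdot>\<^sub>v ws ! i" if "i < n" for i
    using that wsc by (simp add: W_def)
  have W: "W \<in> carrier_mat n n" unfolding W_def by auto
  have k: "k i * cnj (k i) * (ws ! i \<bullet>c ws ! i) = 1" if i: "i < n" for i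
  proof -
    have "ws ! i \<bullet>c ws ! i \<noteq> 0"
      using corthogonalD[OF ws(2), of i i] i len by simp
    moreover have "ws ! i \<bullet>c ws ! i \<ge> 0"
      by (rule conjugate_square_ge_0_vec)
    ultimately have "Re (ws ! i \<bullet>c ws ! i) > 0" "Im (ws ! i \<bullet>c ws ! i) = 0"
      by (auto simp: less_eq_complex_def complex_eq_iff)
    then obtain r where r: "r > 0" "ws ! i \<bullet>c ws ! i = complex_of_real r"
      by (metis complex_is_Real_iff of_real_Re)
    \<comment> \<open>The squared norm is a positive real number, so the complex root \<open>csqrt\<close> is real.\<close>
    have "cnj (k i) = k i" using r by (simp add: k_def)
    moreover have "k i * k i * complex_of_real r = 1"
    proof -
      have "csqrt (complex_of_real r) * csqrt (complex_of_real r) = complex_of_real r"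
        by (metis power2_csqrt power2_eq_square)
      then show ?thesis using r by (simp add: k_def field_simps)
    qed
    ultimately show ?thesis using r(2) by simp
  qed
  have "mat_adjoint W * W = 1\<^sub>m n"
  proof (rule eq_matI)
    fix i j assume "i < dim_row (1\<^sub>m n)" "j < dim_col (1\<^sub>m n)"
    then have i: "i < n" and j: "j < n" by auto
    have "(mat_adjoint W * W) $$ (i, j) = conjugate (col W i) \<bullet> col W j"
      using i j W by (simp add: mat_adjoint_def)
    also have "\<dots> = col W j \<bullet>c col W i"
      using W i j by (intro comm_scalar_prod[of _ n]) auto
    also have "\<dots> = k j * (cnj (k i) * (ws ! j \<bullet>c ws ! i))"
      using wsc[OF i] wsc[OF j] by (simp add: col i j conjugate_smult_vec)
    also have "\<dots> = 1\<^sub>m n $$ (i, j)"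
      using k[OF i] corthogonalD[OF ws(2), of j i] i j len by (auto simp: mult.assoc)
    finally show "(mat_adjoint W * W) $$ (i, j) = 1\<^sub>m n $$ (i, j)" .
  qed (use W in auto)
  moreover have "col W 0 = k 0 \<cdot>\<^sub>v v" using col[of 0] n ws_0 by simp
  ultimately show ?thesis using that W by blast
qed

text \<open>Schur's theorem with a unitary similarity: only a unitary change of basis preserves the inner
  product.  The induction deflates: in an orthonormal basis that starts with an eigenvector, \<open>A\<close> is
  block triangular, and the induction hypothesis triangularizes the remaining block.\<close>

lemma unitary_triangularization:
  fixes A :: "complex mat"
  assumes "A \<in> carrier_mat n n"
  shows "\<exists>U B. similar_mat_wit A B U (mat_adjoint U) \<and> upper_triangular B"
  using assms
proof (induction n arbitrary: A)
  case 0
  then have "similar_mat_wit A A (1\<^sub>m 0) (mat_adjoint (1\<^sub>m 0))"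
    using similar_mat_wit_refl[OF 0] by simp
  moreover have "upper_triangular A" using 0 by auto
  ultimately show ?case by blast
next
  case (Suc n)
  note A = Suc.prems
  from spectrum_non_empty[OF A] obtain e v where ev: "eigenvector A v e"
    by (auto simp: spectrum_def eigenvalue_def)
  then have v: "v \<in> carrier_vec (Suc n)" "v \<noteq> 0\<^sub>v (Suc n)" and Av: "A *\<^sub>v v = e \<cdot>\<^sub>v v"
    using A unfolding eigenvector_def by auto
  obtain W c where W: "W \<in> carrier_mat (Suc n) (Suc n)"
    and W1: "mat_adjoint W * W = 1\<^sub>m (Suc n)" and W_0: "col W 0 = c \<cdot>\<^sub>v v"
    using unitary_with_first_column[OF v] .
  have W2: "W * mat_adjoint W = 1\<^sub>m (Suc n)"
    by (rule mat_mult_left_right_inverse[OF _ W W1]) (use W in simp)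
  define A' where "A' = mat_adjoint W * A * W"
  have W': "mat_adjoint W \<in> carrier_mat (Suc n) (Suc n)" using W by simp
  have A': "A' \<in> carrier_mat (Suc n) (Suc n)" using W A unfolding A'_def by auto
  have "similar_mat_wit A' A (mat_adjoint W) W"
    by (rule similar_mat_witI[of _ _ "Suc n"]) (use W W' A A' W1 W2 in \<open>auto simp: A'_def\<close>)
  then have sim1: "similar_mat_wit A A' W (mat_adjoint W)"
    by (rule similar_mat_wit_sym)
  have W0c: "col W 0 \<in> carrier_vec (Suc n)"
    by (rule col_carrier_vec[OF zero_less_Suc W])
  have "col A' 0 = mat_adjoint W *\<^sub>v (A *\<^sub>v col W 0)"
    unfolding A'_def assoc_mult_mat[OF W' A W] col_mult2[OF W' mult_carrier_mat[OF A W] zero_less_Suc]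
      col_mult2[OF A W zero_less_Suc] ..
  also have "A *\<^sub>v col W 0 = e \<cdot>\<^sub>v col W 0"
    using A v Av by (simp add: W_0 mult_mat_vec smult_smult_assoc mult.commute)
  also have "mat_adjoint W *\<^sub>v (e \<cdot>\<^sub>v col W 0) = e \<cdot>\<^sub>v col (mat_adjoint W * W) 0"
    unfolding col_mult2[OF W' W zero_less_Suc] by (rule mult_mat_vec[OF W' W0c])
  finally have col: "col A' 0 = e \<cdot>\<^sub>v col (1\<^sub>m (Suc n)) 0" using W1 by simp
  have A'0: "A' $$ (Suc i, 0) = 0" if "i < n" for i
    using arg_cong[OF col, of "\<lambda>v. v $ Suc i"] A' that by auto
  obtain A1 A2 A0 A3 where split: "split_block A' 1 1 = (A1, A2, A0, A3)"
    by (cases "split_block A' 1 1") auto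
  from A' have "dim_row A' = 1 + n" "dim_col A' = 1 + n" by auto
  note block = split_block[OF split this]
  have A0: "A0 = 0\<^sub>m n 1"
    using split A'0 A' by (auto simp: split_block_def Let_def)
  from Suc.IH[OF block(4)] obtain U B
    where sim: "similar_mat_wit A3 B U (mat_adjoint U)" and B: "upper_triangular B" by blast
  note UB = similar_mat_witD2[OF block(4) sim]
  define V where "V = four_block_mat (1\<^sub>m 1) (0\<^sub>m 1 n) (0\<^sub>m n 1) U"
  have V': "mat_adjoint V = four_block_mat (1\<^sub>m 1) (0\<^sub>m 1 n) (0\<^sub>m n 1) (mat_adjoint U)"
    using mat_adjoint_four_block[of "1\<^sub>m 1" 1 U n] UB by (simp add: V_def)
  define C where "C = four_block_mat A1 (A2 * U) (0\<^sub>m n 1) B"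
  have "similar_mat_wit A' C V (mat_adjoint V)"
    unfolding V' unfolding V_def C_def block(5) A0
    by (rule similar_mat_wit_four_block[OF similar_mat_wit_refl[OF block(1)] sim _ _ block(1,4)])
      (use UB block in \<open>auto simp: assoc_mult_mat[of _ 1 n _ n _ n]\<close>)
  from similar_mat_wit_trans[OF sim1 this]
  have "similar_mat_wit A C (W * V) (mat_adjoint (W * V))"
    using W UB by (subst mat_adjoint_mult[of _ "Suc n" "Suc n" _ "Suc n"]) (auto simp: V_def)
  moreover have "upper_triangular C"
    unfolding C_def using block(1) UB B by (intro upper_triangular_four_block) auto
  ultimately show ?case by blast
qed

section \<open>Fremdervectors under unitary similarity\<close>

lemma similar_mat_wit_adjoint:
  fixes A :: "'a :: conjugatable_field mat"
  assumes A: "A \<in> carrier_mat n n" and sim: "similar_mat_wit A B U (mat_adjoint U)"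
  shows "similar_mat_wit (mat_adjoint A) (mat_adjoint B) U (mat_adjoint U)"
proof -
  note D = similar_mat_witD2[OF A sim]
  have "mat_adjoint A = U * mat_adjoint B * mat_adjoint U"
    using D(5-7) by (subst D(3))
      (simp add: mat_adjoint_mult[of _ n n _ n] assoc_mult_mat[of _ n n _ n _ n])
  then show ?thesis using D by (intro similar_mat_witI[of _ _ n]) auto
qed

lemma similar_mat_wit_mult_vec:
  assumes M: "M \<in> carrier_mat n n" and sim: "similar_mat_wit M N U V" and x: "x \<in> carrier_vec n"
  shows "M *\<^sub>v x = U *\<^sub>v (N *\<^sub>v (V *\<^sub>v x))"
  using similar_mat_witD2[OF M sim] x by (simp add: assoc_mult_mat_vec[of _ n n _ n])

text \<open>With \<open>x = U y\<close> and \<open>M = U N U\<^sup>\<dagger>\<close>, the quadratic form satisfies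
  \<open>\<langle>x, M x\<rangle> = \<langle>U y, U N y\<rangle> = \<langle>y, N y\<rangle>\<close>, and \<open>U\<close> maps the kernels
  of \<open>N\<close> and of its adjoint into those of \<open>M\<close> and its adjoint.\<close>

lemma nontrivial_fremdervector_unitary:
  assumes M: "M \<in> carrier_mat n n" and sim: "similar_mat_wit M N U (mat_adjoint U)"
    and x: "nontrivial_fremdervector M x"
  shows "nontrivial_fremdervector N (mat_adjoint U *\<^sub>v x)"
proof -
  note D = similar_mat_witD2[OF M sim]
  define y where "y = mat_adjoint U *\<^sub>v x"
  have xc: "x \<in> carrier_vec n" and x0: "x \<bullet>c (M *\<^sub>v x) = 0"
    and xM: "M *\<^sub>v x \<noteq> 0\<^sub>v n" and xM': "mat_adjoint M *\<^sub>v x \<noteq> 0\<^sub>v n"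
    using x M by (auto simp: nontrivial_fremdervector_def fremdervector_def mat_kernel_def)
  have yc: "y \<in> carrier_vec n" using D(7) xc by (simp add: y_def)
  have Mx: "M *\<^sub>v x = U *\<^sub>v (N *\<^sub>v y)"
    unfolding y_def by (rule similar_mat_wit_mult_vec[OF M sim xc])
  have M'x: "mat_adjoint M *\<^sub>v x = U *\<^sub>v (mat_adjoint N *\<^sub>v y)"
    unfolding y_def
    by (rule similar_mat_wit_mult_vec[OF _ similar_mat_wit_adjoint[OF M sim] xc]) (use M in simp)
  have U0: "U *\<^sub>v 0\<^sub>v n = 0\<^sub>v n" using D(6) by auto
  have "y \<bullet>c (N *\<^sub>v y) = x \<bullet>c (M *\<^sub>v x)"
    unfolding Mx y_def using cscalar_prod_mult_mat_vec[OF D(6) xc, of "N *\<^sub>v y"] D(5) yc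
    by (simp add: y_def)
  moreover have "N *\<^sub>v y \<noteq> 0\<^sub>v n" using xM U0 by (auto simp: Mx)
  moreover have "mat_adjoint N *\<^sub>v y \<noteq> 0\<^sub>v n" using xM' U0 by (auto simp: M'x)
  ultimately show ?thesis
    using x0 yc D(5)
    by (auto simp: nontrivial_fremdervector_def fremdervector_def mat_kernel_def y_def)
qed

lemma fremdervalue_unitary_imp:
  assumes A: "A \<in> carrier_mat n n" and sim: "similar_mat_wit A B U (mat_adjoint U)"
    and z: "fremdervalue A z"
  shows "fremdervalue B z"
proof -
  note D = similar_mat_witD2[OF A sim]
  have "z \<cdot>\<^sub>m 1\<^sub>m n - A = U * (z \<cdot>\<^sub>m 1\<^sub>m n - B) * mat_adjoint U"
  proof -
    have "U * (z \<cdot>\<^sub>m 1\<^sub>m n - B) = z \<cdot>\<^sub>m U - U * B"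
      using D by (simp add: mult_minus_distrib_mat[of _ n n _ n] mult_smult_distrib[of _ n n _ n])
    then have "U * (z \<cdot>\<^sub>m 1\<^sub>m n - B) * mat_adjoint U = z \<cdot>\<^sub>m (U * mat_adjoint U) - U * B * mat_adjoint U"
      using D by (simp add: minus_mult_distrib_mat[of _ n n _ _ n] mult_smult_assoc_mat[of _ n n _ n])
    then show ?thesis using D by simp
  qed
  then have "similar_mat_wit (z \<cdot>\<^sub>m 1\<^sub>m n - A) (z \<cdot>\<^sub>m 1\<^sub>m n - B) U (mat_adjoint U)"
    using D by (intro similar_mat_witI[of _ _ n]) auto
  note push = nontrivial_fremdervector_unitary[OF minus_carrier_mat[OF A] this]
  obtain x where "nontrivial_fremdervector (z \<cdot>\<^sub>m 1\<^sub>m n - A) x"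
    using z A unfolding fremdervalue_def by auto
  from push[OF this] show ?thesis
    using D(5) unfolding fremdervalue_def by auto
qed

lemma fremdervalue_unitary_iff:
  assumes A: "A \<in> carrier_mat n n" and sim: "similar_mat_wit A B U (mat_adjoint U)"
  shows "fremdervalue A z \<longleftrightarrow> fremdervalue B z"
proof
  have "similar_mat_wit B A (mat_adjoint U) (mat_adjoint (mat_adjoint U))"
    using similar_mat_wit_sym[OF sim] by simp
  then show "fremdervalue B z \<Longrightarrow> fremdervalue A z"
    using fremdervalue_unitary_imp similar_mat_witD2(5)[OF A sim] by blast
qed (rule fremdervalue_unitary_imp[OF A sim])

section \<open>Diagonal matrices\<close>

lemma diagonal_mat_mult_vec_index:
  fixes D :: "'a :: semiring_1 mat"
  assumes D: "D \<in> carrier_mat n n" and diag: "diagonal_mat D"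
    and y: "y \<in> carrier_vec n" and i: "i < n"
  shows "(D *\<^sub>v y) $ i = D $$ (i, i) * y $ i"
proof -
  have "(D *\<^sub>v y) $ i = (\<Sum>j\<in>{0..<n}. D $$ (i, j) * y $ j)"
    using D y i by (simp add: scalar_prod_def)
  also have "\<dots> = (\<Sum>j\<in>{0..<n}. if j = i then D $$ (i, i) * y $ i else 0)"
    using D diag i by (intro sum.cong) (auto simp: diagonal_mat_def)
  finally show ?thesis using i by simp
qed

text \<open>The weights are \<open>w\<^sub>i = \<bar>y\<^sub>i\<bar>\<^sup>2\<close> for a fremdervector \<open>y\<close>, and every choice of nonnegative
  weights arises from \<open>y\<^sub>i = \<surd>w\<^sub>i\<close>.  For a diagonal matrix, the matrix and its adjoint have the
  same kernel, so nontriviality is one condition.\<close>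

lemma fremdervalue_diagonal_iff:
  assumes D: "D \<in> carrier_mat n n" and diag: "diagonal_mat D"
  shows "fremdervalue D z \<longleftrightarrow>
    (\<exists>w::nat \<Rightarrow> real. (\<forall>i<n. 0 \<le> w i) \<and> (\<Sum>i<n. of_real (w i) * (z - D $$ (i, i))) = 0
      \<and> (\<exists>i<n. of_real (w i) * (z - D $$ (i, i)) \<noteq> 0))"
    (is "_ \<longleftrightarrow> (\<exists>w. ?balanced w)")
proof -
  define M where "M = z \<cdot>\<^sub>m 1\<^sub>m n - D"
  have M: "M \<in> carrier_mat n n" "diagonal_mat M" and M': "diagonal_mat (mat_adjoint M)"
    using D diag by (auto simp: M_def diagonal_mat_def)
  have Mii: "M $$ (i, i) = z - D $$ (i, i)" if "i < n" for i
    using D that by (simp add: M_def)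
  have vec_0: "v = 0\<^sub>v n \<longleftrightarrow> (\<forall>i<n. v $ i = 0)" if "v \<in> carrier_vec n" for v :: "complex vec"
    using that by (auto intro!: eq_vecI)
  have weights: "nontrivial_fremdervector M y \<longleftrightarrow> ?balanced (\<lambda>i. (cmod (y $ i))\<^sup>2)"
    if y: "y \<in> carrier_vec n" for y
  proof -
    have My: "(M *\<^sub>v y) $ i = (z - D $$ (i, i)) * y $ i" if "i < n" for i
      using diagonal_mat_mult_vec_index[OF M y that] Mii[OF that] by simp
    have M'y: "(mat_adjoint M *\<^sub>v y) $ i = cnj (z - D $$ (i, i)) * y $ i" if "i < n" for i
      using diagonal_mat_mult_vec_index[OF mat_adjoint_carrier[OF M(1)] M' y that] Mii[OF that] M(1) that
      by simp
    have carrier: "M *\<^sub>v y \<in> carrier_vec n" "mat_adjoint M *\<^sub>v y \<in> carrier_vec n"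
      using mult_mat_vec_carrier[OF M(1) y]
        mult_mat_vec_carrier[OF mat_adjoint_carrier[OF M(1)] y] .
    have "y \<bullet>c (M *\<^sub>v y) = (\<Sum>i<n. y $ i * cnj ((M *\<^sub>v y) $ i))"
      using M(1) by (simp add: scalar_prod_def lessThan_atLeast0 del: index_mult_mat_vec)
    also have "\<dots> = (\<Sum>i<n. cnj (of_real ((cmod (y $ i))\<^sup>2) * (z - D $$ (i, i))))"
      by (intro sum.cong refl)
        (simp add: My complex_norm_square mult_ac del: of_real_power index_mult_mat_vec)
    finally have form: "y \<bullet>c (M *\<^sub>v y) = cnj (\<Sum>i<n. of_real ((cmod (y $ i))\<^sup>2) * (z - D $$ (i, i)))"
      by (simp only: cnj_sum)
    have ker: "M *\<^sub>v y = 0\<^sub>v n \<longleftrightarrow> (\<forall>i<n. of_real ((cmod (y $ i))\<^sup>2) * (z - D $$ (i, i)) = 0)"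
      unfolding vec_0[OF carrier(1)] using My by auto
    have ker': "mat_adjoint M *\<^sub>v y = 0\<^sub>v n \<longleftrightarrow> M *\<^sub>v y = 0\<^sub>v n"
      unfolding vec_0[OF carrier(1)] vec_0[OF carrier(2)] using My M'y by auto
    have "nontrivial_fremdervector M y \<longleftrightarrow>
        y \<bullet>c (M *\<^sub>v y) = 0 \<and> M *\<^sub>v y \<noteq> 0\<^sub>v n \<and> mat_adjoint M *\<^sub>v y \<noteq> 0\<^sub>v n"
      using M(1) y by (auto simp: nontrivial_fremdervector_def fremdervector_def mat_kernel_def)
    then show ?thesis
      unfolding form ker' ker complex_cnj_zero_iff by (blast intro: zero_le_power2)
  qed
  have z: "fremdervalue D z \<longleftrightarrow> (\<exists>y. nontrivial_fremdervector M y)"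
    using D by (simp add: fremdervalue_def M_def)
  show ?thesis
  proof
    assume "fremdervalue D z"
    then obtain y where y: "nontrivial_fremdervector M y" using z by blast
    then have "y \<in> carrier_vec n"
      using M(1) by (simp add: nontrivial_fremdervector_def fremdervector_def)
    from iffD1[OF weights[OF this] y] show "\<exists>w. ?balanced w"
      by (rule exI[where x = "\<lambda>i. (cmod (y $ i))\<^sup>2"])
  next
    assume "\<exists>w. ?balanced w"
    then obtain w where w: "?balanced w" by blast
    define y where "y = vec n (\<lambda>i. complex_of_real (sqrt (w i)))"
    have yw: "(cmod (y $ i))\<^sup>2 = w i" if "i < n" for i using w that by (simp add: y_def)
    have "(\<Sum>i<n. of_real ((cmod (y $ i))\<^sup>2) * (z - D $$ (i, i)))
        = (\<Sum>i<n. of_real (w i) * (z - D $$ (i, i)))"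
      by (rule sum.cong) (simp_all only: yw lessThan_iff)
    moreover have "\<exists>i<n. of_real ((cmod (y $ i))\<^sup>2) * (z - D $$ (i, i)) \<noteq> 0"
      using w yw by metis
    ultimately have bal: "?balanced (\<lambda>i. (cmod (y $ i))\<^sup>2)"
      using w by (simp only: zero_le_power2 simp_thms)
    have "y \<in> carrier_vec n" by (simp add: y_def)
    from iffD2[OF weights[OF this] bal] show "fremdervalue D z" unfolding z by (rule exI)
  qed
qed

text \<open>If \<open>t\<close> is not strictly between the extreme \<open>r\<^sub>i\<close>, then all summands
  \<open>w\<^sub>i (t - r\<^sub>i)\<close> have the same sign, and a vanishing sum makes each of them vanish.  Otherwise two
  weights suffice, on a minimal and a maximal \<open>r\<^sub>i\<close>.\<close>

lemma balanced_weights_iff: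
  fixes r :: "'i \<Rightarrow> real"
  assumes I: "finite I" "I \<noteq> {}"
  shows "(\<exists>w. (\<forall>i\<in>I. 0 \<le> w i) \<and> (\<Sum>i\<in>I. w i * (t - r i)) = 0 \<and> (\<exists>i\<in>I. w i * (t - r i) \<noteq> 0))
    \<longleftrightarrow> Min (r ` I) < t \<and> t < Max (r ` I)"
proof
  assume "\<exists>w. (\<forall>i\<in>I. 0 \<le> w i) \<and> (\<Sum>i\<in>I. w i * (t - r i)) = 0 \<and> (\<exists>i\<in>I. w i * (t - r i) \<noteq> 0)"
  then obtain w k where w: "\<And>i. i \<in> I \<Longrightarrow> 0 \<le> w i" and s: "(\<Sum>i\<in>I. w i * (t - r i)) = 0"
    and k: "k \<in> I" "w k * (t - r k) \<noteq> 0" by blast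
  show "Min (r ` I) < t \<and> t < Max (r ` I)"
  proof (rule ccontr)
    assume "\<not> (Min (r ` I) < t \<and> t < Max (r ` I))"
    then consider "\<And>i. i \<in> I \<Longrightarrow> t \<le> r i" | "\<And>i. i \<in> I \<Longrightarrow> r i \<le> t"
      using I by (auto simp: not_less)
    then have "\<forall>i\<in>I. w i * (t - r i) = 0"
    proof cases
      case 1
      then show ?thesis
        using sum_nonneg_eq_0_iff[OF I(1), of "\<lambda>i. - (w i * (t - r i))"] s w
        by (auto simp: sum_negf mult_nonneg_nonpos)
    next
      case 2
      then show ?thesis
        using sum_nonneg_eq_0_iff[OF I(1), of "\<lambda>i. w i * (t - r i)"] s w by auto
    qed
    then show False using k by blast
  qed
next
  assume t: "Min (r ` I) < t \<and> t < Max (r ` I)"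
  obtain a b where ab: "a \<in> I" "r a = Min (r ` I)" "b \<in> I" "r b = Max (r ` I)"
    using I Min_in[of "r ` I"] Max_in[of "r ` I"] by fastforce
  then have lt: "r a < t" "t < r b" and ne: "a \<noteq> b" using t by auto
  \<comment> \<open>A lever in equilibrium: each of the two weights is the distance from \<open>t\<close> to the other end.\<close>
  define w where "w i = (if i = a then r b - t else if i = b then t - r a else 0)" for i
  have "(\<Sum>i\<in>I. w i * (t - r i)) = (\<Sum>i\<in>{a, b}. w i * (t - r i))"
    using I ab by (intro sum.mono_neutral_right) (auto simp: w_def)
  also have "\<dots> = 0" using ne by (simp add: w_def algebra_simps)
  finally show "\<exists>w. (\<forall>i\<in>I. 0 \<le> w i) \<and> (\<Sum>i\<in>I. w i * (t - r i)) = 0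
      \<and> (\<exists>i\<in>I. w i * (t - r i) \<noteq> 0)"
    using lt ab ne by (intro exI[of _ w] conjI bexI[of _ a]) (auto simp: w_def)
qed

text \<open>A vanishing weighted sum with positive total weight exhibits \<open>z\<close> as a weighted mean of points
  of the line \<open>c \<real>\<close>.  This forces \<open>z\<close> onto that line and reduces the statement to real
  numbers.\<close>

lemma complex_balanced_weights_iff:
  fixes r :: "'i \<Rightarrow> real" and c z :: complex
  assumes I: "finite I" "I \<noteq> {}" and c: "c \<noteq> 0"
  shows "(\<exists>w::'i \<Rightarrow> real. (\<forall>i\<in>I. 0 \<le> w i) \<and> (\<Sum>i\<in>I. of_real (w i) * (z - c * of_real (r i))) = 0
      \<and> (\<exists>i\<in>I. of_real (w i) * (z - c * of_real (r i)) \<noteq> 0))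
    \<longleftrightarrow> (\<exists>t. z = c * of_real t \<and> Min (r ` I) < t \<and> t < Max (r ` I))" (is "(\<exists>w. ?P z w) \<longleftrightarrow> _")
proof -
  let ?R = "\<lambda>t w. (\<forall>i\<in>I. 0 \<le> w i) \<and> (\<Sum>i\<in>I. w i * (t - r i)) = 0 \<and> (\<exists>i\<in>I. w i * (t - r i) \<noteq> 0)"
  have line: "?P (c * of_real t) w \<longleftrightarrow> ?R t w" for t w
  proof -
    have eq: "of_real (w i) * (c * of_real t - c * of_real (r i)) = c * of_real (w i * (t - r i))" for i
      by (simp add: algebra_simps)
    show ?thesis
      using c by (simp only: eq sum_distrib_left[symmetric] of_real_sum[symmetric]
          mult_eq_0_iff of_real_eq_0_iff simp_thms)
  qed
  have on_line: "\<exists>t. z = c * of_real t" if "?P z w" for w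
  proof -
    let ?S = "\<Sum>i\<in>I. w i"
    from that obtain k where k: "k \<in> I" "w k \<noteq> 0" by auto
    then have S: "?S \<noteq> 0" using that I by (auto simp: sum_nonneg_eq_0_iff)
    have "z * of_real ?S = c * of_real (\<Sum>i\<in>I. w i * r i)"
      using that by (simp add: algebra_simps sum_subtractf sum_distrib_left)
    then have "z = c * of_real ((\<Sum>i\<in>I. w i * r i) / ?S)"
      using S by (simp add: field_simps del: of_real_sum)
    then show ?thesis by blast
  qed
  show ?thesis
  proof
    assume "\<exists>w. ?P z w"
    then obtain w where w: "?P z w" by (rule exE)
    from on_line[OF this] obtain t where t: "z = c * of_real t" by blast
    from w have "?R t w" unfolding t line .
    then have "\<exists>w. ?R t w" by (rule exI[where x = w])
    then have "Min (r ` I) < t \<and> t < Max (r ` I)"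
      unfolding balanced_weights_iff[OF I] .
    with t show "\<exists>t. z = c * of_real t \<and> Min (r ` I) < t \<and> t < Max (r ` I)" by blast
  next
    assume "\<exists>t. z = c * of_real t \<and> Min (r ` I) < t \<and> t < Max (r ` I)"
    then obtain t where t: "z = c * of_real t" and m: "Min (r ` I) < t \<and> t < Max (r ` I)" by blast
    from m show "\<exists>w. ?P z w" unfolding t line balanced_weights_iff[OF I] .
  qed
qed

section \<open>Matrices with spectrum on a line through the origin\<close>

lemma spectrum_triangular:
  fixes A :: "'a :: field mat"
  assumes A: "A \<in> carrier_mat n n" and sim: "similar_mat A B" and B: "upper_triangular B"
    and Bc: "B \<in> carrier_mat n n"
  shows "spectrum A = (\<lambda>i. B $$ (i, i)) ` {..<n}"
proof -
  have "spectrum A = {k. poly (\<Prod>a\<leftarrow>diag_mat B. [:- a, 1:]) k = 0}"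
    unfolding spectrum_root_char_poly[OF A] char_poly_similar[OF sim]
      char_poly_upper_triangular[OF Bc B] ..
  also have "\<dots> = set (diag_mat B)"
    by (auto simp: poly_prod_list prod_list_zero_iff)
  also have "\<dots> = (\<lambda>i. B $$ (i, i)) ` {..<n}"
    using Bc by (auto simp: diag_mat_def)
  finally show ?thesis .
qed

text \<open>The common form of the two cases.  The symmetry is \<open>A\<^sup>\<dagger> = s A\<close>, with \<open>s = 1\<close> or
  \<open>s = -1\<close>.  The last assumption says that it confines each eigenvalue \<open>a\<close> to the line \<open>c \<real>\<close>,
  on which \<open>p\<close> (\<open>Re\<close> or \<open>Im\<close>) is the coordinate.\<close>

lemma fremdervalue_iff_of_adjoint_smult:
  fixes A :: "complex mat" and p :: "complex \<Rightarrow> real"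
  assumes n: "n \<ge> 1" and A: "A \<in> carrier_mat n n"
    and adj: "mat_adjoint A = s \<cdot>\<^sub>m A" and c: "c \<noteq> 0"
    and line: "\<And>a. cnj a = s * a \<Longrightarrow> a = c * of_real (p a)"
  shows "fremdervalue A z \<longleftrightarrow>
    (\<exists>t. z = c * of_real t \<and> Min (p ` spectrum A) < t \<and> t < Max (p ` spectrum A))"
proof -
  obtain U B where sim: "similar_mat_wit A B U (mat_adjoint U)" and ut: "upper_triangular B"
    using unitary_triangularization[OF A] by blast
  note D = similar_mat_witD2[OF A sim]
  have B_adj: "mat_adjoint B = s \<cdot>\<^sub>m B"
  proof -
    have A': "mat_adjoint A \<in> carrier_mat n n" using A by simp
    have B: "B = mat_adjoint U * A * U"
      using similar_mat_witD2(3)[OF D(5) similar_mat_wit_sym[OF sim]] .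
    have "mat_adjoint B = mat_adjoint U * mat_adjoint A * U"
      by (rule similar_mat_witD2(3)[OF _ similar_mat_wit_sym[OF similar_mat_wit_adjoint[OF A sim]]])
        (rule mat_adjoint_carrier[OF D(5)])
    also have "\<dots> = s \<cdot>\<^sub>m (mat_adjoint U * A * U)"
      unfolding adj mult_smult_distrib[OF D(7) A]
      by (rule mult_smult_assoc_mat[OF mult_carrier_mat[OF D(7) A] D(6)])
    finally show ?thesis using B by simp
  qed
  have Bji: "cnj (B $$ (j, i)) = s * B $$ (i, j)" if "i < n" "j < n" for i j
  proof -
    have "cnj (B $$ (j, i)) = mat_adjoint B $$ (i, j)" using that D(5) by simp
    also have "\<dots> = (s \<cdot>\<^sub>m B) $$ (i, j)" by (simp only: B_adj)
    also have "\<dots> = s * B $$ (i, j)" using that D(5) by simp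
    finally show ?thesis .
  qed
  define r where "r i = p (B $$ (i, i))" for i
  have Bd: "B $$ (i, i) = c * of_real (r i)" if "i < n" for i
    unfolding r_def by (rule line[OF Bji[OF that that]])
  \<comment> \<open>The symmetry turns the zeros below the diagonal into zeros above it.\<close>
  have diag: "diagonal_mat B"
    unfolding diagonal_mat_def
  proof (intro allI impI)
    fix i j assume i: "i < dim_row B" and j: "j < dim_col B" and ne: "i \<noteq> j"
    show "B $$ (i, j) = 0"
    proof (cases "j < i")
      case True
      then show ?thesis using ut i by auto
    next
      case False
      then have "cnj (B $$ (i, j)) = 0"
        using Bji[of j i] upper_triangularD[OF ut, of i j] i j ne D(5) by auto
      then show ?thesis by simp
    qed
  qed
  have I: "finite {..<n}" "{..<n} \<noteq> {}" using n by (auto simp: lessThan_empty_iff)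
  have spec: "p ` spectrum A = r ` {..<n}"
    using sim
    by (subst spectrum_triangular[OF A _ ut D(5)]) (auto simp: similar_mat_def image_image r_def)
  have "fremdervalue A z \<longleftrightarrow> (\<exists>w::nat \<Rightarrow> real. (\<forall>i\<in>{..<n}. 0 \<le> w i)
      \<and> (\<Sum>i<n. of_real (w i) * (z - c * of_real (r i))) = 0
      \<and> (\<exists>i\<in>{..<n}. of_real (w i) * (z - c * of_real (r i)) \<noteq> 0))"
    unfolding fremdervalue_unitary_iff[OF A sim] fremdervalue_diagonal_iff[OF D(5) diag]
    by (simp add: Bd Ball_def Bex_def cong: sum.cong_simp conj_cong)
  then show ?thesis
    unfolding complex_balanced_weights_iff[OF I c] spec .
qed

theorem corollary4p8:
  fixes n :: nat and A :: "complex mat"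
  assumes "n \<ge> 1" and "A \<in> carrier_mat n n"
  shows "(hermitian_mat A \<longrightarrow>
           (\<forall>z::complex. fremdervalue A z \<longleftrightarrow>
              z \<in> \<real> \<and> Min (Re ` spectrum A) < Re z \<and> Re z < Max (Re ` spectrum A)))
       \<and> (skew_hermitian_mat A \<longrightarrow>
           (\<forall>z::complex. fremdervalue A z \<longleftrightarrow>
              Re z = 0 \<and> Min (Im ` spectrum A) < Im z \<and> Im z < Max (Im ` spectrum A)))"
proof (intro conjI impI allI)
  fix z
  assume "hermitian_mat A"
  then have "mat_adjoint A = 1 \<cdot>\<^sub>m A" unfolding hermitian_mat_def by auto
  then have "fremdervalue A z \<longleftrightarrow>
      (\<exists>t. z = 1 * of_real t \<and> Min (Re ` spectrum A) < t \<and> t < Max (Re ` spectrum A))"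
    by (rule fremdervalue_iff_of_adjoint_smult[OF assms]) (auto simp: complex_eq_iff)
  then show "fremdervalue A z \<longleftrightarrow>
      z \<in> \<real> \<and> Min (Re ` spectrum A) < Re z \<and> Re z < Max (Re ` spectrum A)"
    by (auto elim: Reals_cases)
next
  fix z
  assume "skew_hermitian_mat A"
  then have "mat_adjoint A = (- 1) \<cdot>\<^sub>m A" unfolding skew_hermitian_mat_def by auto
  then have "fremdervalue A z \<longleftrightarrow>
      (\<exists>t. z = \<i> * of_real t \<and> Min (Im ` spectrum A) < t \<and> t < Max (Im ` spectrum A))"
    by (rule fremdervalue_iff_of_adjoint_smult[OF assms]) (auto simp: complex_eq_iff)
  then show "fremdervalue A z \<longleftrightarrow>
      Re z = 0 \<and> Min (Im ` spectrum A) < Im z \<and> Im z < Max (Im ` spectrum A)"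
    by (auto simp: complex_eq_iff)
qed

end
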